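(* Let $\mathscr D,\mathscr Q$ be disjoint schemas. Every DTGD$[\mathsf{CQ}]$-ontology over $(\mathscr D,\mathscr Q)$ is defined by a finite set of TGDs; that is, for every finite set $\Sigma$ of DTGDs such that $[\![\Sigma]\!]^{\mathsf{CQ}}_{\mathscr D,\mathscr Q}$ is an OMQA$[\mathsf{CQ}]$-ontology, there is a finite set $\Sigma'$ of TGDs with $[\![\Sigma']\!]^{\mathsf{CQ}}_{\mathscr D,\mathscr Q}=[\![\Sigma]\!]^{\mathsf{CQ}}_{\mathscr D,\mathscr Q}$.
   Context: Terms are constants (from a set $\Delta$), labeled nulls, or variables. A fact is a variable-free relational atom; an instance is a set of facts; a database is a finite instance with no nulls; $adom(I)$ is its set of constants. A Boolean CQ (BCQ) is a sentence $\exists\mathbf y\,\varphi$ with $\varphi$ a nonempty finite conjunction of relational atoms (constants allowed); $\mathsf{CQ}$ denotes the class of BCQs; $const(q)$ is the set of constants of $q$. A DTGD is a sentence $\forall\mathbf x\forall\mathbf y(\phi(\mathbf x,\mathbf y)\rightarrow\exists\mathbf z(\psi_1(\mathbf x,\mathbf z)\vee\dots\vee\psi_k(\mathbf x,\mathbf z)))$ with $\phi$ and all $\psi_i$ conjunctions of relational atoms (no equalities), each variable of $\mathbf x$ occurring in $\phi$; a TGD is a DTGD with $k=1$. $D\cup\Sigma\vDash q$ means every instance containing $D$ and satisfying $\Sigma$ satisfies $q$. For disjoint schemas $\mathscr D,\mathscr Q$, an OMQA$[\mathsf{CQ}]$-ontology over $(\mathscr D,\mathscr Q)$ is a set $O$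 of pairs $(D,q)$, $D$ a nonempty $\mathscr D$-database, $q$ a $\mathscr Q$-BCQ with $const(q)\subseteq adom(D)$, closed under: (1) if $(D,p),(D,q)\in O$ then $(D,p\wedge q)\in O$; (2) if $p$ a BCQ, $q\vDash p$, $(D,q)\in O$ then $(D,p)\in O$; (3) if $(D,q)\in O$ and there is an injective map $h$ on $adom(D)$, fixing $const(q)$, with $h(D)\subseteq D'$ for a database $D'$, then $(D',q)\in O$; (4) if $(D,q)\in O$ and $\tau$ is a partial injective map $\Delta\to\Delta$ then $(\tau(D),\tau(q))\in O$. $[\![\Sigma]\!]^{\mathsf{CQ}}_{\mathscr D,\mathscr Q}$ is the set of pairs $(D,q)$ with $D$ a $\mathscr D$-database, $q$ a $\mathscr Q$-BCQ and $D\cup\Sigma\vDash q$. A DTGD$[\mathsf{CQ}]$-ontology is an OMQA$[\mathsf{CQ}]$-ontology $O$ with $O=[\![\Sigma]\!]^{\mathsf{CQ}}_{\mathscr D,\mathscr Q}$ for some finite set $\Sigma$ of DTGDs ("defined by $\Sigma$"). *)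

theory Defs
  imports Main "HOL-Library.Infinite_Typeclass"
begin

section \<open>Relational vocabulary\<close>

text \<open>
  The type \<open>'c\<close> plays the role of the set of constants; labeled nulls and variables are
  natural numbers. Whether nulls or variables may occur is fixed by the type of the arguments:
  an atom over \<open>'c val\<close> is a fact, over \<open>'c\<close> a null-free fact, and over \<open>'c trm\<close> an atom of a
  query or a rule. Schemas are sets of relation symbols; rules are not tied to a schema, so they
  may use auxiliary symbols.
\<close>

datatype 's relsym = RelSym (symbol_name: 's) (arity: nat)

datatype (dead 's, terms: 't) atom = Atom (rel: "'s relsym") (args: "'t list")

datatype 'c val = Const 'c | Null nat

datatype (trm_consts: 'c) trm = Cst 'c | Var nat

primrec trm_vars :: "'c trm \<Rightarrow> nat set" where
  "trm_vars (Cst c) = {}"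
| "trm_vars (Var x) = {x}"

type_synonym ('s, 'c) "instance" = "('s, 'c val) atom set"
type_synonym ('s, 'c) database = "('s, 'c) atom set"
type_synonym ('s, 'c) conj = "('s, 'c trm) atom list"

definition wf_atom :: "('s, 't) atom \<Rightarrow> bool" where
  "wf_atom a \<longleftrightarrow> length (args a) = arity (rel a)"

definition is_instance :: "('s, 'c) instance \<Rightarrow> bool" where
  "is_instance I \<longleftrightarrow> (\<forall>a\<in>I. wf_atom a)"

definition is_database :: "'s relsym set \<Rightarrow> ('s, 'c) database \<Rightarrow> bool" where
  "is_database S D \<longleftrightarrow> finite D \<and> (\<forall>a\<in>D. wf_atom a \<and> rel a \<in> S)"

definition adom :: "('s, 'c) database \<Rightarrow> 'c set" where
  "adom D = (\<Union>a\<in>D. terms a)"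

definition database_instance :: "('s, 'c) database \<Rightarrow> ('s, 'c) instance" where
  "database_instance D = map_atom Const ` D"

definition conj_vars :: "('s, 'c) conj \<Rightarrow> nat set" where
  "conj_vars \<phi> = (\<Union>a\<in>set \<phi>. \<Union>t\<in>terms a. trm_vars t)"

definition conj_consts :: "('s, 'c) conj \<Rightarrow> 'c set" where
  "conj_consts \<phi> = (\<Union>a\<in>set \<phi>. \<Union>t\<in>terms a. trm_consts t)"

primrec eval_trm :: "(nat \<Rightarrow> 'c val) \<Rightarrow> 'c trm \<Rightarrow> 'c val" where
  "eval_trm \<mu> (Cst c) = Const c"
| "eval_trm \<mu> (Var x) = \<mu> x"

definition conj_holds :: "('s, 'c) instance \<Rightarrow> (nat \<Rightarrow> 'c val) \<Rightarrow> ('s, 'c) conj \<Rightarrow> bool" where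
  "conj_holds I \<mu> \<phi> \<longleftrightarrow> (\<forall>a\<in>set \<phi>. map_atom (eval_trm \<mu>) a \<in> I)"


section \<open>Boolean conjunctive queries\<close>

text \<open>
  A query is given by its quantifier-free part: all variables are existentially quantified.
\<close>

type_synonym ('s, 'c) bcq = "('s, 'c) conj"

definition is_bcq :: "'s relsym set \<Rightarrow> ('s, 'c) bcq \<Rightarrow> bool" where
  "is_bcq S q \<longleftrightarrow> q \<noteq> [] \<and> (\<forall>a\<in>set q. wf_atom a \<and> rel a \<in> S)"

definition sat_bcq :: "('s, 'c) instance \<Rightarrow> ('s, 'c) bcq \<Rightarrow> bool" where
  "sat_bcq I q \<longleftrightarrow> (\<exists>\<mu>. conj_holds I \<mu> q)"

definition bcq_entails :: "('s, 'c) bcq \<Rightarrow> ('s, 'c) bcq \<Rightarrow> bool" where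
  "bcq_entails q p \<longleftrightarrow> (\<forall>I. is_instance I \<longrightarrow> sat_bcq I q \<longrightarrow> sat_bcq I p)"

primrec rename_trm :: "(nat \<Rightarrow> nat) \<Rightarrow> 'c trm \<Rightarrow> 'c trm" where
  "rename_trm f (Cst c) = Cst c"
| "rename_trm f (Var x) = Var (f x)"

text \<open>
  The bound variables of the two conjuncts are renamed apart before the quantifiers are merged.
\<close>

definition bcq_conj :: "('s, 'c) bcq \<Rightarrow> ('s, 'c) bcq \<Rightarrow> ('s, 'c) bcq" where
  "bcq_conj p q = map (map_atom (rename_trm (\<lambda>x. 2 * x))) p
                  @ map (map_atom (rename_trm (\<lambda>x. 2 * x + 1))) q"


section \<open>Disjunctive tuple-generating dependencies\<close>

text \<open>
  The three blocks of quantified variables are not recorded. A head variable that occurs in the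
  body is universally quantified and shared with the body, any other head variable is
  existentially quantified. Constants may occur in bodies and heads.
\<close>

datatype ('s, 'c) dtgd = DTGD (body: "('s, 'c) conj") (heads: "('s, 'c) conj list")

definition is_dtgd :: "('s, 'c) dtgd \<Rightarrow> bool" where
  "is_dtgd \<sigma> \<longleftrightarrow> heads \<sigma> \<noteq> [] \<and> (\<forall>\<phi>\<in>insert (body \<sigma>) (set (heads \<sigma>)). \<forall>a\<in>set \<phi>. wf_atom a)"

definition is_tgd :: "('s, 'c) dtgd \<Rightarrow> bool" where
  "is_tgd \<sigma> \<longleftrightarrow> is_dtgd \<sigma> \<and> length (heads \<sigma>) = 1"

definition sat_dtgd :: "('s, 'c) instance \<Rightarrow> ('s, 'c) dtgd \<Rightarrow> bool" where
  "sat_dtgd I \<sigma> \<longleftrightarrow>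
     (\<forall>\<mu>. conj_holds I \<mu> (body \<sigma>) \<longrightarrow>
       (\<exists>\<nu>. (\<forall>x\<in>conj_vars (body \<sigma>). \<nu> x = \<mu> x) \<and> (\<exists>\<psi>\<in>set (heads \<sigma>). conj_holds I \<nu> \<psi>)))"

definition entails :: "('s, 'c) database \<Rightarrow> ('s, 'c) dtgd set \<Rightarrow> ('s, 'c) bcq \<Rightarrow> bool" where
  "entails D \<Sigma> q \<longleftrightarrow>
     (\<forall>I. is_instance I \<and> database_instance D \<subseteq> I \<and> (\<forall>\<sigma>\<in>\<Sigma>. sat_dtgd I \<sigma>) \<longrightarrow> sat_bcq I q)"


section \<open>Ontologies\<close>

definition defined_ontology ::
  "'s relsym set \<Rightarrow> 's relsym set \<Rightarrow> ('s, 'c) dtgd set \<Rightarrow> (('s, 'c) database \<times> ('s, 'c) bcq) set" where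
  "defined_ontology \<D> \<Q> \<Sigma> = {(D, q). is_database \<D> D \<and> is_bcq \<Q> q \<and> entails D \<Sigma> q}"

text \<open>
  In the last closure condition the partial map has to be defined on all constants of \<open>D\<close>, and
  hence on those of \<open>q\<close>, so the use of \<^const>\<open>the\<close> is harmless.
\<close>

definition omqa_ontology ::
  "'s relsym set \<Rightarrow> 's relsym set \<Rightarrow> (('s, 'c) database \<times> ('s, 'c) bcq) set \<Rightarrow> bool" where
  "omqa_ontology \<D> \<Q> ont \<longleftrightarrow>
     (\<forall>(D, q)\<in>ont. is_database \<D> D \<and> D \<noteq> {} \<and> is_bcq \<Q> q \<and> conj_consts q \<subseteq> adom D) \<and>
     (\<forall>D p q. (D, p) \<in> ont \<and> (D, q) \<in> ont \<longrightarrow> (D, bcq_conj p q) \<in> ont) \<and>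
     (\<forall>D p q. is_bcq UNIV p \<and> bcq_entails q p \<and> (D, q) \<in> ont \<longrightarrow> (D, p) \<in> ont) \<and>
     (\<forall>D q h D'. (D, q) \<in> ont \<and> inj_on h (adom D) \<and> (\<forall>c\<in>conj_consts q. h c = c) \<and>
        is_database \<D> D' \<and> map_atom h ` D \<subseteq> D' \<longrightarrow> (D', q) \<in> ont) \<and>
     (\<forall>D q \<tau>. (D, q) \<in> ont \<and> inj_on \<tau> (dom \<tau>) \<and> adom D \<subseteq> dom \<tau> \<longrightarrow>
        (map_atom (the \<circ> \<tau>) ` D, map (map_atom (map_trm (the \<circ> \<tau>))) q) \<in> ont)"

end

theory Submission
  imports Defs
begin

text \<open>
  A disjunctive choice is simulated by worlds: a rule that fires in the world \<open>u\<close> splits \<open>u\<close> into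
  one world per disjunct. A conjunctive query holds in two instances iff it holds in their direct
  product, so TGDs can propagate what is certain in both parts of a split back to \<open>u\<close> by deriving
  the facts of the product there. Hence if a query fails in the initial world, it fails along some
  branch of splits, and the limit of these worlds is a model of the disjunctive rules refuting it.
  Conversely, a model of the disjunctive rules is a world whose siblings may be taken to satisfy
  every fact; the products involved may then be replaced by projections.
\<close>

section \<open>Conjunctions\<close>

text \<open>The limit is the obstacle that shapes the rules. If every world containing a given match
  of a body could bring its own existential witnesses, no fixed finite set of head instances would
  recur from world to world, and none need survive in the limit. Hence the witnesses are recorded in
  a fact that does not mention the world, and only the choice of a disjunct is left to the splits.
  This is why a projection can stand in for the product when a model of the disjunctive rules is
  turned into a model of the TGDs.\<close>

lemma map_atom_eq: "map_atom g a = Atom (rel a) (map g (args a))"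
  by (cases a) simp

lemma terms_eq: "terms a = set (args a)"
  by (cases a) simp

lemma eval_trm_cong: "(\<And>x. x \<in> trm_vars t \<Longrightarrow> \<mu> x = \<nu> x) \<Longrightarrow> eval_trm \<mu> t = eval_trm \<nu> t"
  by (cases t) auto

lemma conj_holds_cong:
  assumes "\<And>x. x \<in> conj_vars \<phi> \<Longrightarrow> \<mu> x = \<nu> x"
  shows "conj_holds I \<mu> \<phi> \<longleftrightarrow> conj_holds I \<nu> \<phi>"
proof -
  have "map_atom (eval_trm \<mu>) a = map_atom (eval_trm \<nu>) a" if "a \<in> set \<phi>" for a
  proof (rule atom.map_cong0)
    fix t assume "t \<in> terms a"
    then have "trm_vars t \<subseteq> conj_vars \<phi>"
      using that by (auto simp: conj_vars_def)
    then show "eval_trm \<mu> t = eval_trm \<nu> t"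
      using assms by (intro eval_trm_cong) auto
  qed
  then show ?thesis
    by (simp add: conj_holds_def)
qed

lemma conj_holds_Nil [simp]: "conj_holds I \<mu> []"
  by (simp add: conj_holds_def)

lemma conj_holds_Cons [simp]:
  "conj_holds I \<mu> (a # \<phi>) \<longleftrightarrow> Atom (rel a) (map (eval_trm \<mu>) (args a)) \<in> I \<and> conj_holds I \<mu> \<phi>"
  by (simp add: conj_holds_def map_atom_eq)

lemma conj_holds_append [simp]:
  "conj_holds I \<mu> (\<phi> @ \<psi>) \<longleftrightarrow> conj_holds I \<mu> \<phi> \<and> conj_holds I \<mu> \<psi>"
  by (auto simp: conj_holds_def)

lemma conj_holds_map [simp]:
  "conj_holds I \<mu> (map g xs) \<longleftrightarrow>
     (\<forall>x\<in>set xs. Atom (rel (g x)) (map (eval_trm \<mu>) (args (g x))) \<in> I)"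
  by (simp add: conj_holds_def map_atom_eq)

lemma conj_holds_iff_subset: "conj_holds I \<mu> \<phi> \<longleftrightarrow> map_atom (eval_trm \<mu>) ` set \<phi> \<subseteq> I"
  by (auto simp: conj_holds_def)

lemma conj_holds_mono: "conj_holds I \<mu> \<phi> \<Longrightarrow> I \<subseteq> J \<Longrightarrow> conj_holds J \<mu> \<phi>"
  by (auto simp: conj_holds_def)

text \<open>Only the symbols of the conjunction matter here, so queries can ignore auxiliary facts
  and rule bodies can ignore foreign facts of the database.\<close>

lemma conj_holds_restrict:
  assumes "\<And>a. rel a \<in> rel ` set \<phi> \<Longrightarrow> a \<in> I \<Longrightarrow> a \<in> J" "conj_holds I \<mu> \<phi>"
  shows "conj_holds J \<mu> \<phi>"
  using assms by (auto simp: conj_holds_def map_atom_eq)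

lemma finite_conj_vars [simp]: "finite (conj_vars (\<phi> :: ('s, 'c) conj))"
proof -
  have "finite (trm_vars t)" for t :: "'c trm"
    by (cases t) auto
  then show ?thesis
    by (simp add: conj_vars_def terms_eq)
qed

lemma sat_tgd_iff:
  "sat_dtgd I (DTGD b [h]) \<longleftrightarrow>
     (\<forall>\<mu>. conj_holds I \<mu> b \<longrightarrow> (\<exists>\<nu>. (\<forall>x\<in>conj_vars b. \<nu> x = \<mu> x) \<and> conj_holds I \<nu> h))"
  by (simp add: sat_dtgd_def)

lemma sat_tgdI:
  assumes "\<And>\<mu>. conj_holds I \<mu> b \<Longrightarrow> conj_holds I \<mu> h"
  shows "sat_dtgd I (DTGD b [h])"
  using assms by (auto simp: sat_tgd_iff)

lemma full_tgdD:
  assumes "sat_dtgd I (DTGD b [h])" "conj_vars h \<subseteq> conj_vars b" "conj_holds I \<mu> b"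
  shows "conj_holds I \<mu> h"
proof -
  obtain \<nu> where \<nu>: "\<forall>x\<in>conj_vars b. \<nu> x = \<mu> x" "conj_holds I \<nu> h"
    using assms by (auto simp: sat_tgd_iff)
  have "conj_holds I \<nu> h \<longleftrightarrow> conj_holds I \<mu> h"
    using assms(2) \<nu>(1) by (intro conj_holds_cong) auto
  then show ?thesis
    using \<nu> by simp
qed


section \<open>Maximal finitely covered sets\<close>

text \<open>Being finitely covered has finite character: a finite subset of the union of a chain
  already lies in one member, so Zorn's lemma applies.\<close>

lemma ex_maximal_finitely_covered:
  fixes \<W> :: "'a set set"
  assumes "\<W> \<noteq> {}"
  shows "\<exists>I. (\<forall>F. finite F \<longrightarrow> F \<subseteq> I \<longrightarrow> (\<exists>W\<in>\<W>. F \<subseteq> W)) \<and>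
    (\<forall>J. I \<subseteq> J \<longrightarrow> (\<forall>F. finite F \<longrightarrow> F \<subseteq> J \<longrightarrow> (\<exists>W\<in>\<W>. F \<subseteq> W)) \<longrightarrow> J = I)"
proof -
  define \<G> where "\<G> = {I. \<forall>F. finite F \<longrightarrow> F \<subseteq> I \<longrightarrow> (\<exists>W\<in>\<W>. F \<subseteq> W)}"
  have "\<exists>M\<in>\<G>. \<forall>X\<in>\<G>. M \<subseteq> X \<longrightarrow> X = M"
  proof (rule subset_Zorn_nonempty)
    have "{} \<in> \<G>"
      using assms by (auto simp: \<G>_def)
    then show "\<G> \<noteq> {}"
      by blast
  next
    fix \<C>
    assume \<C>: "\<C> \<noteq> {}" "subset.chain \<G> \<C>"
    have "\<exists>W\<in>\<W>. F \<subseteq> W" if F: "finite F" "F \<subseteq> \<Union>\<C>" for F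
    proof -
      obtain X where "X \<in> \<C>" "F \<subseteq> X"
        using finite_subset_Union_chain[OF F \<C>] by blast
      moreover have "X \<in> \<G>"
        using \<C>(2) \<open>X \<in> \<C>\<close> by (auto simp: subset.chain_def)
      ultimately show ?thesis
        using F(1) by (simp add: \<G>_def)
    qed
    then show "\<Union>\<C> \<in> \<G>"
      by (simp add: \<G>_def)
  qed
  then obtain I where I: "I \<in> \<G>" "\<forall>X\<in>\<G>. I \<subseteq> X \<longrightarrow> X = I"
    by blast
  show ?thesis
  proof (intro exI conjI allI impI)
    show "\<exists>W\<in>\<W>. F \<subseteq> W" if "finite F" "F \<subseteq> I" for F
      using I(1) that by (simp add: \<G>_def)
    show "J = I" if "I \<subseteq> J" "\<forall>F. finite F \<longrightarrow> F \<subseteq> J \<longrightarrow> (\<exists>W\<in>\<W>. F \<subseteq> W)" for J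
      using I(2) that by (simp add: \<G>_def)
  qed
qed

text \<open>
  Sets \<open>\<W>\<close> that meet a requirement only after being enlarged, with the enlargement depending on
  the set, still have a common limit \<open>I\<close> meeting all requirements at once; this replaces a fair
  disjunctive chase and works for domains of any cardinality.
\<close>

lemma ex_saturated_limit:
  fixes \<W> :: "'a set set"
  assumes ne: "\<W> \<noteq> {}" and base: "\<And>W. W \<in> \<W> \<Longrightarrow> D \<subseteq> W"
  shows "\<exists>I. D \<subseteq> I \<and> (\<forall>F. finite F \<longrightarrow> F \<subseteq> I \<longrightarrow> (\<exists>W\<in>\<W>. F \<subseteq> W)) \<and>
    (\<forall>B \<H>. finite B \<longrightarrow> B \<subseteq> I \<longrightarrow> finite \<H> \<longrightarrow>
       (\<forall>W\<in>\<W>. B \<subseteq> W \<longrightarrow> (\<exists>W'\<in>\<W>. W \<subseteq> W' \<and> (\<exists>H\<in>\<H>. H \<subseteq> W'))) \<longrightarrow>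
       (\<exists>H\<in>\<H>. H \<subseteq> I))"
proof -
  obtain I where cov: "\<And>F. finite F \<Longrightarrow> F \<subseteq> I \<Longrightarrow> \<exists>W\<in>\<W>. F \<subseteq> W"
    and max: "\<And>J. I \<subseteq> J \<Longrightarrow> (\<And>F. finite F \<Longrightarrow> F \<subseteq> J \<Longrightarrow> \<exists>W\<in>\<W>. F \<subseteq> W) \<Longrightarrow> J = I"
    using ex_maximal_finitely_covered[OF ne] by auto
  \<comment> \<open>By maximality, \<open>H\<close> can fail to lie in \<open>I\<close> only if some
    finite part of \<open>I\<close> occurs together with \<open>H\<close> in no member of
    \<open>\<W>\<close>.\<close>
  have ext: "H \<subseteq> I" if "\<And>F. finite F \<Longrightarrow> F \<subseteq> I \<Longrightarrow> \<exists>W\<in>\<W>. F \<subseteq> W \<and> H \<subseteq> W" for H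
  proof -
    have "I \<union> H = I"
    proof (rule max)
      fix F assume "finite F" "F \<subseteq> I \<union> H"
      then have "\<exists>W\<in>\<W>. F \<inter> I \<subseteq> W \<and> H \<subseteq> W"
        by (intro that) auto
      then obtain W where "W \<in> \<W>" "F \<inter> I \<subseteq> W" "H \<subseteq> W"
        by blast
      then show "\<exists>W\<in>\<W>. F \<subseteq> W"
        using \<open>F \<subseteq> I \<union> H\<close> by blast
    qed auto
    then show ?thesis by blast
  qed
  show ?thesis
  proof (intro exI[of _ I] conjI allI impI)
    show "D \<subseteq> I"
    proof (rule ext)
      fix F assume "finite F" "F \<subseteq> I"
      then obtain W where "W \<in> \<W>" "F \<subseteq> W"
        using cov by meson
      then show "\<exists>W\<in>\<W>. F \<subseteq> W \<and> D \<subseteq> W"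
        using base by auto
    qed
  next
    fix F assume "finite F" "F \<subseteq> I"
    then show "\<exists>W\<in>\<W>. F \<subseteq> W" by (rule cov)
  next
    fix B \<H>
    assume B: "finite B" "B \<subseteq> I" and \<H>: "finite \<H>"
      and step: "\<forall>W\<in>\<W>. B \<subseteq> W \<longrightarrow> (\<exists>W'\<in>\<W>. W \<subseteq> W' \<and> (\<exists>H\<in>\<H>. H \<subseteq> W'))"
    show "\<exists>H\<in>\<H>. H \<subseteq> I"
    proof (rule ccontr)
      assume "\<not> (\<exists>H\<in>\<H>. H \<subseteq> I)"
      \<comment> \<open>Take one obstruction \<open>F H\<close> per candidate. Being finitely many,
        they fit together with \<open>B\<close> into a single \<open>W\<close>; enlarging
        \<open>W\<close> adds some \<open>H\<close> and keeps \<open>F H\<close>, a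
        contradiction.\<close>
      then have "\<forall>H\<in>\<H>. \<exists>F. finite F \<and> F \<subseteq> I \<and> \<not> (\<exists>W\<in>\<W>. F \<subseteq> W \<and> H \<subseteq> W)"
        using ext by meson
      then obtain F where F: "\<And>H. H \<in> \<H> \<Longrightarrow> finite (F H) \<and> F H \<subseteq> I"
        "\<And>H W. H \<in> \<H> \<Longrightarrow> W \<in> \<W> \<Longrightarrow> F H \<subseteq> W \<Longrightarrow> \<not> H \<subseteq> W"
        by metis
      have "finite (B \<union> (\<Union>H\<in>\<H>. F H))" "B \<union> (\<Union>H\<in>\<H>. F H) \<subseteq> I"
        using B \<H> F(1) by auto
      then obtain W where "W \<in> \<W>" "B \<union> (\<Union>H\<in>\<H>. F H) \<subseteq> W"
        using cov by meson
      then have "\<exists>W'\<in>\<W>. W \<subseteq> W' \<and> (\<exists>H\<in>\<H>. H \<subseteq> W')"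
        by (intro step[rule_format]) auto
      then obtain W' H where W': "W' \<in> \<W>" "W \<subseteq> W'" "H \<in> \<H>" "H \<subseteq> W'"
        by blast
      have "F H \<subseteq> W'"
        using \<open>B \<union> (\<Union>H\<in>\<H>. F H) \<subseteq> W\<close> W' by blast
      then show False
        using F(2) W' by simp
    qed
  qed
qed


section \<open>The simulating rules\<close>

text \<open>
  \<open>Star R\<close> is \<open>R\<close> with a world as additional first argument. \<open>Ev \<sigma>\<close> fixes
  witnesses for the existential variables of \<open>\<sigma>\<close> that do not depend on the world. \<open>Or(u, v, v')\<close>
  says that the worlds \<open>v\<close> and \<open>v'\<close> split the case \<open>u\<close>. \<open>Pair(v, x, x', y)\<close> makes \<open>y\<close> the
  element \<open>(x, x')\<close> of a product whose first factor is the world \<open>v\<close>.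
\<close>

datatype ('s, 'c) aux = Star "'s relsym" | Ev "('s, 'c) dtgd" | Or | Pair | Elem | Root

definition dtgd_conjs :: "('s, 'c) dtgd \<Rightarrow> ('s, 'c) conj set" where
  "dtgd_conjs \<sigma> = insert (body \<sigma>) (set (heads \<sigma>))"

text \<open>The variables of the body and of all disjuncts are listed, so an \<open>Ev\<close> fact
  fixes a full instance of the rule. Sorting only fixes the order of its arguments.\<close>

definition dtgd_vars :: "('s, 'c) dtgd \<Rightarrow> nat list" where
  "dtgd_vars \<sigma> = sorted_list_of_set (\<Union>\<phi>\<in>dtgd_conjs \<sigma>. conj_vars \<phi>)"

definition dtgd_syms :: "('s, 'c) dtgd set \<Rightarrow> 's relsym set" where
  "dtgd_syms \<Sigma> = (\<Union>\<sigma>\<in>\<Sigma>. \<Union>\<phi>\<in>dtgd_conjs \<sigma>. rel ` set \<phi>)"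

definition aux_names :: "('s, 'c) dtgd set \<Rightarrow> ('s, 'c) aux set" where
  "aux_names \<Sigma> = Star ` dtgd_syms \<Sigma> \<union> Ev ` \<Sigma> \<union> {Or, Pair, Elem, Root}"

primrec aux_arity :: "('s, 'c) aux \<Rightarrow> nat" where
  "aux_arity (Star R) = Suc (arity R)"
| "aux_arity (Ev \<sigma>) = length (dtgd_vars \<sigma>)"
| "aux_arity Or = 3"
| "aux_arity Pair = 4"
| "aux_arity Elem = 1"
| "aux_arity Root = 1"

lemma finite_dtgd_syms: "finite \<Sigma> \<Longrightarrow> finite (dtgd_syms \<Sigma>)"
  by (auto simp: dtgd_syms_def dtgd_conjs_def)

lemma finite_aux_names: "finite \<Sigma> \<Longrightarrow> finite (aux_names \<Sigma>)"
  by (simp add: aux_names_def finite_dtgd_syms)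

lemma set_dtgd_vars: "set (dtgd_vars \<sigma>) = (\<Union>\<phi>\<in>dtgd_conjs \<sigma>. conj_vars \<phi>)"
  unfolding dtgd_vars_def by (rule set_sorted_list_of_set) (simp add: dtgd_conjs_def)

lemma ex_fresh_symbols:
  fixes ar :: "'n \<Rightarrow> nat" and X :: "'s relsym set"
  assumes "finite A" and spare: "\<And>n. infinite {R. arity R = n \<and> R \<notin> X}"
  shows "\<exists>f. inj_on f A \<and> (\<forall>n\<in>A. arity (f n) = ar n \<and> f n \<notin> X)"
  using \<open>finite A\<close>
proof induction
  case (insert m A)
  then obtain f where f: "inj_on f A" "\<forall>n\<in>A. arity (f n) = ar n \<and> f n \<notin> X"
    by blast
  have "infinite ({R. arity R = ar m \<and> R \<notin> X} - f ` A)"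
    using spare insert.hyps(1) by (intro Diff_infinite_finite) auto
  then obtain R where "R \<in> {R. arity R = ar m \<and> R \<notin> X} - f ` A"
    using infinite_imp_nonempty by blast
  then have "inj_on (f(m := R)) (insert m A) \<and>
      (\<forall>n\<in>insert m A. arity ((f(m := R)) n) = ar n \<and> (f(m := R)) n \<notin> X)"
    using f insert.hyps(2) by (auto simp: inj_on_def)
  then show ?case by blast
qed auto

text \<open>
  The variables \<open>k\<close>, \<open>k + 3\<close>, \<open>k + 6\<close>, \<open>\<dots>\<close>: the indices 0, 1, 2 are kept for worlds, and the
  offsets 3, 4, 5 give three disjoint tuples.
\<close>

definition tup :: "nat \<Rightarrow> nat \<Rightarrow> 'c trm list" where
  "tup k n = map (\<lambda>j. Var (3 * j + k)) [0..<n]"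

text \<open>Subtracting 1 from the quotient skips the block 0, 1, 2 that is reserved for
  worlds.\<close>

definition asg ::
  "'v \<Rightarrow> 'v \<Rightarrow> 'v \<Rightarrow> 'v list \<Rightarrow> 'v list \<Rightarrow> 'v list \<Rightarrow> nat \<Rightarrow> 'v" where
  "asg u v v' xs ys zs i =
     (if i = 0 then u else if i = 1 then v else if i = 2 then v'
      else (if i mod 3 = 0 then xs else if i mod 3 = 1 then ys else zs) ! (i div 3 - 1))"

lemma asg_world [simp]:
  "asg u v v' xs ys zs 0 = u" "asg u v v' xs ys zs (Suc 0) = v" "asg u v v' xs ys zs 2 = v'"
  by (simp_all add: asg_def)

lemma asg_nth [simp]:
  "asg u v v' xs ys zs (3 * j + 3) = xs ! j"
  "asg u v v' xs ys zs (3 * j + 4) = ys ! j"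
  "asg u v v' xs ys zs (3 * j + 5) = zs ! j"
proof -
  have "(3 * j + 3) mod 3 = 0" "(3 * j + 3) div 3 = j + 1"
    "(3 * j + 4) mod 3 = 1" "(3 * j + 4) div 3 = j + 1"
    "(3 * j + 5) mod 3 = 2" "(3 * j + 5) div 3 = j + 1"
    by presburger+
  then show "asg u v v' xs ys zs (3 * j + 3) = xs ! j"
    "asg u v v' xs ys zs (3 * j + 4) = ys ! j"
    "asg u v v' xs ys zs (3 * j + 5) = zs ! j"
    by (simp_all add: asg_def)
qed

lemma length_tup [simp]: "length (tup k n) = n"
  by (simp add: tup_def)

lemma eval_tup: "map (eval_trm \<mu>) (tup k n) = map (\<lambda>j. \<mu> (3 * j + k)) [0..<n]"
  by (simp add: tup_def)

lemma eval_tup_asg [simp]: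
  "length xs = n \<Longrightarrow> map (eval_trm (asg u v v' xs ys zs)) (tup 3 n) = xs"
  "length ys = n \<Longrightarrow> map (eval_trm (asg u v v' xs ys zs)) (tup 4 n) = ys"
  "length zs = n \<Longrightarrow> map (eval_trm (asg u v v' xs ys zs)) (tup 5 n) = zs"
  by (auto simp: eval_tup intro: nth_equalityI)

section \<open>Translation of the disjunctive rules into TGDs\<close>

locale simulation =
  fixes \<D> \<Q> :: "'s relsym set"
    and \<Sigma> :: "('s, 'c) dtgd set"
    and f :: "('s, 'c) aux \<Rightarrow> 's relsym"
  assumes disjoint: "\<D> \<inter> \<Q> = {}"
    and finite_rules: "finite \<Sigma>"
    and dtgds: "\<sigma> \<in> \<Sigma> \<Longrightarrow> is_dtgd \<sigma>"
    and arity_f: "n \<in> aux_names \<Sigma> \<Longrightarrow> arity (f n) = aux_arity n"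
    and fresh_f: "n \<in> aux_names \<Sigma> \<Longrightarrow> f n \<notin> \<D> \<union> \<Q>"
    and inj_f: "inj_on f (aux_names \<Sigma>)"
begin

abbreviation S :: "'s relsym set" where
  "S \<equiv> dtgd_syms \<Sigma>"

lemma aux_namesI [simp]:
  "R \<in> S \<Longrightarrow> Star R \<in> aux_names \<Sigma>" "\<sigma> \<in> \<Sigma> \<Longrightarrow> Ev \<sigma> \<in> aux_names \<Sigma>"
  "Or \<in> aux_names \<Sigma>" "Pair \<in> aux_names \<Sigma>" "Elem \<in> aux_names \<Sigma>" "Root \<in> aux_names \<Sigma>"
  by (auto simp: aux_names_def)

text \<open>Variables of a rule of \<open>\<Sigma>\<close> are doubled, leaving the odd numbers for worlds.\<close>

definition star :: "nat \<Rightarrow> ('s, 'c) conj \<Rightarrow> ('s, 'c) conj" where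
  "star i = map (\<lambda>a. Atom (f (Star (rel a))) (Var i # map (rename_trm (\<lambda>x. 2 * x)) (args a)))"

text \<open>The restriction to \<open>S\<close> is there because the locale says nothing about
  \<open>f (Star R)\<close> for other symbols.\<close>

definition world :: "('s, 'c) instance \<Rightarrow> 'c val \<Rightarrow> ('s, 'c) instance" where
  "world J u = {a. rel a \<in> S \<and> Atom (f (Star (rel a))) (u # args a) \<in> J}"

text \<open>As \<open>Or\<close> is binary, k disjuncts take k - 1 nested splits: the world
  \<open>i + 2\<close> receives the first disjunct and \<open>i + 4\<close> is split further.
  Started at 1, all worlds have odd indices and so stay apart from the doubled rule
  variables.\<close>

fun chain :: "nat \<Rightarrow> ('s, 'c) conj list \<Rightarrow> ('s, 'c) conj" where
  "chain i [] = []"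
| "chain i [\<psi>] = star i \<psi>"
| "chain i (\<psi> # \<psi>s) =
     Atom (f Or) [Var i, Var (i + 2), Var (i + 4)] # star (i + 2) \<psi> @ chain (i + 4) \<psi>s"

definition Ev_atom :: "('s, 'c) dtgd \<Rightarrow> ('s, 'c trm) atom" where
  "Ev_atom \<sigma> = Atom (f (Ev \<sigma>)) (map (\<lambda>x. Var (2 * x)) (dtgd_vars \<sigma>))"

definition root_rule where
  "root_rule = DTGD [] [[Atom (f Root) [Var 0], Atom (f Elem) [Var 0]]]"

definition load_rule where
  "load_rule R = DTGD [Atom (f Root) [Var 0], Atom R (tup 3 (arity R))]
     [[Atom (f (Star R)) (Var 0 # tup 3 (arity R))]]"

definition answer_rule where
  "answer_rule R = DTGD [Atom (f Root) [Var 0], Atom (f (Star R)) (Var 0 # tup 3 (arity R))]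
     [[Atom R (tup 3 (arity R))]]"

text \<open>\<open>Elem\<close> acts as a domain predicate: the variables to be paired must occur in
  the bodies of the pairing rules, which therefore reach exactly the recorded elements.\<close>

definition elem_rule where
  "elem_rule R = DTGD [Atom (f (Star R)) (Var 0 # tup 3 (arity R))]
     [map (\<lambda>t. Atom (f Elem) [t]) (tup 3 (arity R))]"

definition inherit_rule where
  "inherit_rule R =
     DTGD [Atom (f Or) [Var 0, Var 1, Var 2], Atom (f (Star R)) (Var 0 # tup 3 (arity R))]
       [[Atom (f (Star R)) (Var 1 # tup 3 (arity R)), Atom (f (Star R)) (Var 2 # tup 3 (arity R))]]"

definition product_rule where
  "product_rule R =
     DTGD ([Atom (f Or) [Var 0, Var 1, Var 2], Atom (f (Star R)) (Var 1 # tup 3 (arity R)),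
         Atom (f (Star R)) (Var 2 # tup 4 (arity R))] @
         map (\<lambda>j. Atom (f Pair) [Var 1, Var (3 * j + 3), Var (3 * j + 4), Var (3 * j + 5)])
           [0..<arity R])
       [[Atom (f (Star R)) (Var 0 # tup 5 (arity R))]]"

definition world_rule where
  "world_rule = DTGD [Atom (f Or) [Var 0, Var 1, Var 2]]
     [[Atom (f Elem) [Var 1], Atom (f Elem) [Var 2]]]"

definition pair_rule where
  "pair_rule = DTGD [Atom (f Elem) [Var 0], Atom (f Elem) [Var 1], Atom (f Elem) [Var 2]]
     [[Atom (f Pair) [Var 0, Var 1, Var 2, Var 3]]]"

definition diag_rule where
  "diag_rule = DTGD [Atom (f Elem) [Var 0], Atom (f Elem) [Var 1]]
     [[Atom (f Pair) [Var 0, Var 1, Var 1, Var 1]]]"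

definition witness_rule where
  "witness_rule \<sigma> = DTGD (star 1 (body \<sigma>)) [[Ev_atom \<sigma>]]"

text \<open>
  The atom \<open>Elem\<close> only ensures that the world occurs in the body of the rule even if the body of
  \<open>\<sigma>\<close> is empty.
\<close>

definition split_rule where
  "split_rule \<sigma> =
     DTGD (Atom (f Elem) [Var 1] # Ev_atom \<sigma> # star 1 (body \<sigma>)) [chain 1 (heads \<sigma>)]"

definition rules :: "('s, 'c) dtgd set" where
  "rules = {root_rule, world_rule, pair_rule, diag_rule}
     \<union> load_rule ` (S \<inter> \<D>) \<union> answer_rule ` (S \<inter> \<Q>)
     \<union> elem_rule ` S \<union> inherit_rule ` S \<union> product_rule ` S
     \<union> witness_rule ` \<Sigma> \<union> split_rule ` \<Sigma>"

lemmas rule_defs = root_rule_def load_rule_def answer_rule_def elem_rule_def inherit_rule_def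
  product_rule_def world_rule_def pair_rule_def diag_rule_def witness_rule_def split_rule_def

section \<open>Finiteness and well-formedness of the simulating rules\<close>

lemma finite_simulation: "finite rules"
  using finite_dtgd_syms[OF finite_rules] finite_rules by (simp add: rules_def)

lemma syms_conjs: "\<sigma> \<in> \<Sigma> \<Longrightarrow> \<phi> \<in> dtgd_conjs \<sigma> \<Longrightarrow> rel ` set \<phi> \<subseteq> S"
  by (auto simp: dtgd_syms_def)

lemma wf_conjs: "\<sigma> \<in> \<Sigma> \<Longrightarrow> \<phi> \<in> dtgd_conjs \<sigma> \<Longrightarrow> a \<in> set \<phi> \<Longrightarrow> wf_atom a"
  using dtgds[of \<sigma>] by (auto simp: is_dtgd_def dtgd_conjs_def)

lemma body_conj: "body \<sigma> \<in> dtgd_conjs \<sigma>" and head_conj: "\<psi> \<in> set (heads \<sigma>) \<Longrightarrow> \<psi> \<in> dtgd_conjs \<sigma>"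
  by (auto simp: dtgd_conjs_def)

lemma conj_holds_star:
  assumes "rel ` set \<phi> \<subseteq> S"
  shows "conj_holds J \<mu> (star i \<phi>) \<longleftrightarrow> conj_holds (world J (\<mu> i)) (\<lambda>x. \<mu> (2 * x)) \<phi>"
proof -
  have "eval_trm \<mu> \<circ> rename_trm (\<lambda>x. 2 * x) = eval_trm (\<lambda>x. \<mu> (2 * x))"
  proof
    fix t :: "'c trm"
    show "(eval_trm \<mu> \<circ> rename_trm (\<lambda>x. 2 * x)) t = eval_trm (\<lambda>x. \<mu> (2 * x)) t"
      by (cases t) auto
  qed
  then show ?thesis
    using assms by (auto simp: conj_holds_def star_def world_def map_atom_eq)
qed

lemma conj_vars_star_le: "conj_vars (star i \<phi>) \<subseteq> insert i ((*) 2 ` conj_vars \<phi>)"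
proof -
  have "trm_vars (rename_trm g t) = g ` trm_vars t" for g and t :: "'c trm"
    by (cases t) auto
  then show ?thesis
    by (auto simp: conj_vars_def star_def terms_eq image_UN)
qed

lemma conj_vars_star_ge: "x \<in> conj_vars \<phi> \<Longrightarrow> 2 * x \<in> conj_vars (star i \<phi>)"
proof -
  have "trm_vars (rename_trm g t) = g ` trm_vars t" for g and t :: "'c trm"
    by (cases t) auto
  then show "x \<in> conj_vars \<phi> \<Longrightarrow> 2 * x \<in> conj_vars (star i \<phi>)"
    by (fastforce simp: conj_vars_def star_def terms_eq)
qed

lemma wf_star:
  assumes "\<sigma> \<in> \<Sigma>" "\<phi> \<in> dtgd_conjs \<sigma>"
  shows "\<forall>a\<in>set (star i \<phi>). wf_atom a"
proof -
  have "arity (f (Star (rel b))) = Suc (length (args b))" if "b \<in> set \<phi>" for b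
    using assms that wf_conjs[OF assms that] syms_conjs[OF assms]
    by (subst arity_f) (auto simp: wf_atom_def)
  then show ?thesis
    by (auto simp: star_def wf_atom_def)
qed

lemma wf_chain:
  assumes "\<sigma> \<in> \<Sigma>" "set \<psi>s \<subseteq> dtgd_conjs \<sigma>"
  shows "\<forall>a\<in>set (chain i \<psi>s). wf_atom a"
  using assms(2)
proof (induction i \<psi>s rule: chain.induct)
  case (2 i \<psi>)
  then show ?case using wf_star[OF assms(1)] by simp
next
  case (3 i \<psi> \<psi>' \<psi>s)
  then have "\<forall>a\<in>set (star (i + 2) \<psi>). wf_atom a" "\<forall>a\<in>set (chain (i + 4) (\<psi>' # \<psi>s)). wf_atom a"
    using wf_star[OF assms(1), of \<psi>] by auto
  moreover have "arity (f Or) = 3"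
    by (simp add: arity_f)
  ultimately show ?case
    by (auto simp: wf_atom_def)
qed simp

lemma wf_Ev_atom: "\<sigma> \<in> \<Sigma> \<Longrightarrow> wf_atom (Ev_atom \<sigma>)"
  by (simp add: Ev_atom_def wf_atom_def arity_f)

lemma tgds_simulation:
  assumes "\<rho> \<in> rules"
  shows "is_tgd \<rho>"
proof -
  have "is_tgd (witness_rule \<sigma>)" "is_tgd (split_rule \<sigma>)" if "\<sigma> \<in> \<Sigma>" for \<sigma>
  proof -
    have "set (heads \<sigma>) \<subseteq> dtgd_conjs \<sigma>"
      by (auto simp: dtgd_conjs_def)
    from wf_Ev_atom[OF that] wf_star[OF that body_conj] wf_chain[OF that this]
    show "is_tgd (witness_rule \<sigma>)" "is_tgd (split_rule \<sigma>)"
      by (auto simp: is_tgd_def is_dtgd_def witness_rule_def split_rule_def wf_atom_def arity_f)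
  qed
  moreover have "is_tgd (load_rule R)" "is_tgd (answer_rule R)" "is_tgd (elem_rule R)"
    "is_tgd (inherit_rule R)" "is_tgd (product_rule R)" if "R \<in> S" for R
    using that by (auto simp: is_tgd_def is_dtgd_def rule_defs wf_atom_def arity_f)
  moreover have "is_tgd root_rule" "is_tgd world_rule" "is_tgd pair_rule" "is_tgd diag_rule"
    by (auto simp: is_tgd_def is_dtgd_def rule_defs wf_atom_def arity_f)
  ultimately show ?thesis
    using assms by (auto simp: rules_def)
qed

end


section \<open>Soundness of the simulation\<close>

text \<open>
  A model \<open>I\<close> of \<open>\<Sigma>\<close> becomes a model of the simulating rules with only two kinds of worlds: in
  \<open>Null 0\<close> exactly the facts of \<open>I\<close> hold, in all others every fact holds. The product of two worlds
  one of which is \<open>Null 0\<close> is projected to that factor.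
\<close>

primrec aux_holds :: "('s, 'c) instance \<Rightarrow> ('s, 'c) aux \<Rightarrow> 'c val list \<Rightarrow> bool" where
  "aux_holds I (Star R) as \<longleftrightarrow> (hd as = Null 0 \<longrightarrow> Atom R (tl as) \<in> I)"
| "aux_holds I (Ev \<sigma>) as \<longleftrightarrow> (\<exists>\<nu>. as = map \<nu> (dtgd_vars \<sigma>) \<and>
     (conj_holds I \<nu> (body \<sigma>) \<longrightarrow> (\<exists>\<psi>\<in>set (heads \<sigma>). conj_holds I \<nu> \<psi>)))"
| "aux_holds I Or as \<longleftrightarrow> (as ! 0 = Null 0 \<longleftrightarrow> as ! 1 = Null 0 \<or> as ! 2 = Null 0)"
| "aux_holds I Pair as \<longleftrightarrow> 
     (as ! 0 = Null 0 \<longrightarrow> as ! 3 = as ! 1) \<and> (as ! 0 \<noteq> Null 0 \<longrightarrow> as ! 3 = as ! 2)"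
| "aux_holds I Elem as \<longleftrightarrow> True"
| "aux_holds I Root as \<longleftrightarrow> hd as = Null 0"

context simulation
begin

text \<open>Symbols of \<open>\<Sigma>\<close> outside \<open>\<D>\<close> and \<open>\<Q>\<close>
  occur in \<open>rules\<close> only in starred form. Hence \<open>f\<close> may even reuse them,
  and it suffices that \<open>f\<close> avoids the two schemas.\<close>

definition two_worlds :: "('s, 'c) instance \<Rightarrow> ('s, 'c) instance" where
  "two_worlds I = {a. wf_atom a \<and> (if rel a \<in> \<D> \<union> \<Q> then a \<in> I
     else \<exists>n\<in>aux_names \<Sigma>. rel a = f n \<and> aux_holds I n (args a))}"

lemma two_worlds_aux [simp]:
  assumes "n \<in> aux_names \<Sigma>"
  shows "Atom (f n) as \<in> two_worlds I \<longleftrightarrow> length as = aux_arity n \<and> aux_holds I n as"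
proof -
  have "f n = f m \<longleftrightarrow> m = n" if "m \<in> aux_names \<Sigma>" for m
    using inj_f assms that by (auto dest: inj_onD)
  then show ?thesis
    using assms fresh_f[OF assms] by (auto simp: two_worlds_def wf_atom_def arity_f)
qed

lemma two_worlds_base:
  assumes "R \<in> \<D> \<union> \<Q>"
  shows "Atom R as \<in> two_worlds I \<longleftrightarrow> length as = arity R \<and> Atom R as \<in> I"
  using assms by (auto simp: two_worlds_def wf_atom_def)

lemma world_two_worlds:
  "world (two_worlds I) u = {a. rel a \<in> S \<and> wf_atom a \<and> (u = Null 0 \<longrightarrow> a \<in> I)}"
  by (auto simp: world_def wf_atom_def)

text \<open>The label \<open>Null 0\<close> is handed down the chain until it meets a disjunct true
  in \<open>I\<close>; all other new worlds are \<open>Null 1\<close>, where every disjunct holds.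
  Keeping \<open>\<mu>\<close> on even indices and up to \<open>i\<close> protects the rule
  variables and the worlds already chosen.\<close>

lemma two_worlds_chain:
  assumes "\<sigma> \<in> \<Sigma>" "set \<psi>s \<subseteq> dtgd_conjs \<sigma>" "\<psi>s \<noteq> []" "odd i"
    and "\<mu> i = Null 0 \<Longrightarrow> \<exists>\<psi>\<in>set \<psi>s. conj_holds I (\<lambda>x. \<mu> (2 * x)) \<psi>"
  shows "\<exists>\<nu>. (\<forall>x. even x \<or> x \<le> i \<longrightarrow> \<nu> x = \<mu> x) \<and> conj_holds (two_worlds I) \<nu> (chain i \<psi>s)"
proof -
  have star: "conj_holds (two_worlds I) \<nu> (star j \<psi>)"
    if "\<psi> \<in> dtgd_conjs \<sigma>" "\<nu> j = Null 0 \<Longrightarrow> conj_holds I (\<lambda>x. \<nu> (2 * x)) \<psi>" for \<nu> j \<psi>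
  proof -
    have "wf_atom (map_atom (eval_trm (\<lambda>x. \<nu> (2 * x))) a)" if "a \<in> set \<psi>" for a
      using wf_conjs[OF assms(1) \<open>\<psi> \<in> dtgd_conjs \<sigma>\<close> that] by (simp add: wf_atom_def map_atom_eq)
    then show ?thesis
      using syms_conjs[OF assms(1) \<open>\<psi> \<in> dtgd_conjs \<sigma>\<close>] that(2)
      by (subst conj_holds_star) (auto simp: conj_holds_def world_two_worlds map_atom_eq)
  qed
  show ?thesis
    using assms(2-5)
  proof (induction i \<psi>s arbitrary: \<mu> rule: chain.induct)
    case (2 i \<psi>)
    then have "conj_holds (two_worlds I) \<mu> (chain i [\<psi>])"
      using star by auto
    then show ?case by auto
  next
    case (3 i \<psi> \<psi>' \<psi>s)
    define p where "p \<longleftrightarrow> conj_holds I (\<lambda>x. \<mu> (2 * x)) \<psi>"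
    define \<mu>' where "\<mu>' = \<mu>(i + 2 := if \<mu> i = Null 0 \<and> p then Null 0 else Null 1,
                             i + 4 := if \<mu> i = Null 0 \<and> \<not> p then Null 0 else Null 1)"
    have even: "\<mu>' x = \<mu> x" if "even x \<or> x \<le> i" for x
      using that \<open>odd i\<close> by (auto simp: \<mu>'_def)
    have "\<exists>\<nu>. (\<forall>x. even x \<or> x \<le> i + 4 \<longrightarrow> \<nu> x = \<mu>' x) \<and>
        conj_holds (two_worlds I) \<nu> (chain (i + 4) (\<psi>' # \<psi>s))"
    proof (rule "3.IH")
      show "\<exists>\<psi>\<in>set (\<psi>' # \<psi>s). conj_holds I (\<lambda>x. \<mu>' (2 * x)) \<psi>" if "\<mu>' (i + 4) = Null 0"
      proof -
        have "\<mu> i = Null 0" "\<not> p"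
          using that by (auto simp: \<mu>'_def split: if_splits)
        then show ?thesis
          using "3.prems"(4) by (simp add: even p_def)
      qed
    qed (use "3.prems" in auto)
    then obtain \<nu> where \<nu>: "\<And>x. even x \<or> x \<le> i + 4 \<Longrightarrow> \<nu> x = \<mu>' x"
      "conj_holds (two_worlds I) \<nu> (chain (i + 4) (\<psi>' # \<psi>s))"
      by blast
    have w: "\<nu> i = \<mu> i" "\<nu> (i + 2) = (if \<mu> i = Null 0 \<and> p then Null 0 else Null 1)"
      "\<nu> (i + 4) = (if \<mu> i = Null 0 \<and> \<not> p then Null 0 else Null 1)"
      by (auto simp: \<nu>(1) \<mu>'_def)
    have "conj_holds (two_worlds I) \<nu> (star (i + 2) \<psi>)"
    proof (rule star)
      show "\<psi> \<in> dtgd_conjs \<sigma>" using "3.prems" by auto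
      assume "\<nu> (i + 2) = Null 0"
      then have p using w by (auto split: if_splits)
      then show "conj_holds I (\<lambda>x. \<nu> (2 * x)) \<psi>"
        by (simp add: p_def \<nu>(1) even)
    qed
    moreover have "Atom (f Or) [\<nu> i, \<nu> (i + 2), \<nu> (i + 4)] \<in> two_worlds I"
      unfolding w by simp
    ultimately have "conj_holds (two_worlds I) \<nu> (chain i (\<psi> # \<psi>' # \<psi>s))"
      using \<nu>(2) by simp
    then show ?case
      using \<nu>(1) even by (intro exI[of _ \<nu>]) auto
  qed simp
qed

text \<open>The starred body may hold merely because its world satisfies everything. If it fails in
  \<open>I\<close>, any values serve, since the condition on \<open>Ev\<close> is then vacuous;
  otherwise \<open>I\<close> provides the witnesses.\<close>

lemma two_worlds_witness:
  assumes "\<sigma> \<in> \<Sigma>" "sat_dtgd I \<sigma>"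
  shows "sat_dtgd (two_worlds I) (witness_rule \<sigma>)"
  unfolding witness_rule_def sat_tgd_iff
proof (intro allI impI)
  fix \<mu> :: "nat \<Rightarrow> 'c val"
  have "\<exists>\<nu>. (\<forall>x\<in>conj_vars (body \<sigma>). \<nu> x = \<mu> (2 * x)) \<and>
      (conj_holds I \<nu> (body \<sigma>) \<longrightarrow> (\<exists>\<psi>\<in>set (heads \<sigma>). conj_holds I \<nu> \<psi>))"
  proof (cases "conj_holds I (\<lambda>x. \<mu> (2 * x)) (body \<sigma>)")
    case True
    then show ?thesis using assms(2) unfolding sat_dtgd_def by blast
  next
    case False
    then show ?thesis by (intro exI[of _ "\<lambda>x. \<mu> (2 * x)"]) simp
  qed
  then obtain \<nu> where \<nu>: "\<forall>x\<in>conj_vars (body \<sigma>). \<nu> x = \<mu> (2 * x)"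
    "conj_holds I \<nu> (body \<sigma>) \<longrightarrow> (\<exists>\<psi>\<in>set (heads \<sigma>). conj_holds I \<nu> \<psi>)"
    by blast
  define \<nu>' where "\<nu>' x = (if even x then \<nu> (x div 2) else \<mu> x)" for x
  have "\<nu>' x = \<mu> x" if "x \<in> conj_vars (star 1 (body \<sigma>))" for x
    using that conj_vars_star_le[of 1 "body \<sigma>"] \<nu>(1) by (auto simp: \<nu>'_def)
  moreover have "conj_holds (two_worlds I) \<nu>' [Ev_atom \<sigma>]"
    using assms(1) \<nu>(2) by (auto simp: Ev_atom_def \<nu>'_def comp_def)
  ultimately show "\<exists>\<nu>'. (\<forall>x\<in>conj_vars (star 1 (body \<sigma>)). \<nu>' x = \<mu> x) \<and>
      conj_holds (two_worlds I) \<nu>' [Ev_atom \<sigma>]"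
    by blast
qed

text \<open>In the world \<open>Null 0\<close> the body holds in \<open>I\<close>, so the
  \<open>Ev\<close> fact guarantees a disjunct true in \<open>I\<close>. In any other world nothing
  has to be guaranteed.\<close>

lemma two_worlds_split:
  assumes "\<sigma> \<in> \<Sigma>"
  shows "sat_dtgd (two_worlds I) (split_rule \<sigma>)"
  unfolding split_rule_def sat_tgd_iff
proof (intro allI impI)
  fix \<mu> :: "nat \<Rightarrow> 'c val"
  let ?b = "Atom (f Elem) [Var 1] # Ev_atom \<sigma> # star 1 (body \<sigma>)"
  assume b: "conj_holds (two_worlds I) \<mu> ?b"
  then have "conj_holds (two_worlds I) \<mu> (star 1 (body \<sigma>))"
    by simp
  then have body: "conj_holds (world (two_worlds I) (\<mu> 1)) (\<lambda>x. \<mu> (2 * x)) (body \<sigma>)"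
    by (simp add: conj_holds_star syms_conjs[OF assms body_conj])
  from b obtain \<nu> where \<nu>: "map (\<lambda>x. \<mu> (2 * x)) (dtgd_vars \<sigma>) = map \<nu> (dtgd_vars \<sigma>)"
    "conj_holds I \<nu> (body \<sigma>) \<longrightarrow> (\<exists>\<psi>\<in>set (heads \<sigma>). conj_holds I \<nu> \<psi>)"
    using assms by (auto simp: Ev_atom_def comp_def)
  have cong: "conj_holds I (\<lambda>x. \<mu> (2 * x)) \<phi> \<longleftrightarrow> conj_holds I \<nu> \<phi>" if "\<phi> \<in> dtgd_conjs \<sigma>" for \<phi>
    using \<nu>(1) that by (intro conj_holds_cong) (auto simp: set_dtgd_vars)
  have heads: "\<exists>\<psi>\<in>set (heads \<sigma>). conj_holds I (\<lambda>x. \<mu> (2 * x)) \<psi>" if "\<mu> 1 = Null 0"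
  proof -
    have "conj_holds I (\<lambda>x. \<mu> (2 * x)) (body \<sigma>)"
      using body that by (auto simp: world_two_worlds conj_holds_def)
    then show ?thesis
      using \<nu>(2) cong body_conj head_conj by blast
  qed
  have "set (heads \<sigma>) \<subseteq> dtgd_conjs \<sigma>" "heads \<sigma> \<noteq> []"
    using dtgds[OF assms] by (auto simp: dtgd_conjs_def is_dtgd_def)
  then obtain \<nu>' where \<nu>': "\<forall>x. even x \<or> x \<le> 1 \<longrightarrow> \<nu>' x = \<mu> x"
    "conj_holds (two_worlds I) \<nu>' (chain 1 (heads \<sigma>))"
    using two_worlds_chain[OF assms, of "heads \<sigma>" 1 \<mu> I] heads by auto
  \<comment> \<open>These are the indices on which \<open>two_worlds_chain\<close> leaves
    \<open>\<mu>\<close> unchanged.\<close>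
  have "conj_vars ?b \<subseteq> {1} \<union> range ((*) 2) \<union> conj_vars (star 1 (body \<sigma>))"
    by (auto simp: conj_vars_def Ev_atom_def)
  then have "conj_vars ?b \<subseteq> {x. even x \<or> x \<le> 1}"
    using conj_vars_star_le[of 1 "body \<sigma>"] by fastforce
  then show "\<exists>\<nu>. (\<forall>x\<in>conj_vars ?b. \<nu> x = \<mu> x) \<and> conj_holds (two_worlds I) \<nu> (chain 1 (heads \<sigma>))"
    using \<nu>' by (intro exI[of _ \<nu>']) auto
qed

text \<open>Only \<open>u = Null 0\<close> needs an argument. Then \<open>Or\<close> makes one
  factor \<open>Null 0\<close>, and the pairs project to such a factor. Testing \<open>v\<close>
  alone is enough: if \<open>v\<close> is not \<open>Null 0\<close>, then \<open>v'\<close>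
  is.\<close>

lemma two_worlds_product:
  assumes "R \<in> S"
  shows "sat_dtgd (two_worlds I) (product_rule R)"
  unfolding product_rule_def
proof (rule sat_tgdI, goal_cases)
  case (1 \<mu>)
  let ?t = "\<lambda>k. map (\<lambda>j. \<mu> (3 * j + k)) [0..<arity R]"
  have Or: "Atom (f Or) [\<mu> 0, \<mu> 1, \<mu> 2] \<in> two_worlds I"
    and v: "Atom (f (Star R)) (\<mu> 1 # ?t 3) \<in> two_worlds I"
    and v': "Atom (f (Star R)) (\<mu> 2 # ?t 4) \<in> two_worlds I"
    and pairs: "\<And>j. j < arity R \<Longrightarrow>
      Atom (f Pair) [\<mu> 1, \<mu> (3 * j + 3), \<mu> (3 * j + 4), \<mu> (3 * j + 5)] \<in> two_worlds I"
    using 1 by (simp_all add: eval_tup del: two_worlds_aux)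
  have pair: "\<mu> (3 * j + 5) = (if \<mu> 1 = Null 0 then \<mu> (3 * j + 3) else \<mu> (3 * j + 4))"
    if "j < arity R" for j
    using pairs[OF that] by simp
  have "?t 5 = (if \<mu> 1 = Null 0 then ?t 3 else ?t 4)"
    using pair by (cases "\<mu> 1 = Null 0") (auto intro!: map_cong)
  then have "Atom (f (Star R)) (\<mu> 0 # ?t 5) \<in> two_worlds I"
    using assms Or v v' by (auto split: if_splits)
  then show ?case
    by (simp add: eval_tup del: two_worlds_aux)
qed

lemma two_worlds_sat:
  assumes sat: "\<And>\<sigma>. \<sigma> \<in> \<Sigma> \<Longrightarrow> sat_dtgd I \<sigma>" and "\<rho> \<in> rules"
  shows "sat_dtgd (two_worlds I) \<rho>"
proof -
  have "sat_dtgd (two_worlds I) root_rule"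
    unfolding root_rule_def sat_tgd_iff by (auto simp: conj_vars_def intro!: exI[of _ "\<lambda>_. Null 0"])
  moreover have "sat_dtgd (two_worlds I) world_rule" "sat_dtgd (two_worlds I) diag_rule"
    unfolding world_rule_def diag_rule_def by (auto intro!: sat_tgdI)
  moreover have "sat_dtgd (two_worlds I) pair_rule"
    unfolding pair_rule_def sat_tgd_iff
  proof (intro allI impI)
    fix \<mu> :: "nat \<Rightarrow> 'c val"
    let ?\<nu> = "\<mu>(3 := if \<mu> 0 = Null 0 then \<mu> 1 else \<mu> 2)"
    show "\<exists>\<nu>. (\<forall>x\<in>conj_vars [Atom (f Elem) [Var 0], Atom (f Elem) [Var 1], Atom (f Elem) [Var 2]].
        \<nu> x = \<mu> x) \<and> conj_holds (two_worlds I) \<nu> [Atom (f Pair) [Var 0, Var 1, Var 2, Var 3]]"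
      by (intro exI[of _ ?\<nu>]) (auto simp: conj_vars_def)
  qed
  moreover have "sat_dtgd (two_worlds I) (load_rule R)" if "R \<in> S \<inter> \<D>" for R
    unfolding load_rule_def using that by (auto intro!: sat_tgdI simp: two_worlds_base)
  moreover have "sat_dtgd (two_worlds I) (answer_rule R)" if "R \<in> S \<inter> \<Q>" for R
    unfolding answer_rule_def using that by (auto intro!: sat_tgdI simp: two_worlds_base)
  moreover have "sat_dtgd (two_worlds I) (elem_rule R)" "sat_dtgd (two_worlds I) (inherit_rule R)"
    if "R \<in> S" for R
    unfolding elem_rule_def inherit_rule_def using that by (auto intro!: sat_tgdI)
  ultimately show ?thesis
    using assms(2) sat two_worlds_product two_worlds_witness two_worlds_split
    by (auto simp: rules_def)
qed

lemma entails_if_simulated: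
  assumes D: "is_database \<D> D" and q: "is_bcq \<Q> q" and ent: "entails D rules q"
  shows "entails D \<Sigma> q"
  unfolding entails_def
proof (intro allI impI, elim conjE)
  fix I :: "('s, 'c) instance"
  assume I: "is_instance I" "database_instance D \<subseteq> I" "\<forall>\<sigma>\<in>\<Sigma>. sat_dtgd I \<sigma>"
  have "is_instance (two_worlds I)"
    by (auto simp: is_instance_def two_worlds_def)
  moreover have "database_instance D \<subseteq> two_worlds I"
    using I(1,2) D
    by (auto simp: two_worlds_def database_instance_def is_database_def wf_atom_def map_atom_eq)
  ultimately obtain \<mu> where "conj_holds (two_worlds I) \<mu> q"
    using ent two_worlds_sat I(3) unfolding entails_def sat_bcq_def by blast
  then have "conj_holds I \<mu> q"
    by (rule conj_holds_restrict[rotated]) (use q in \<open>auto simp: two_worlds_def is_bcq_def\<close>)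
  then show "sat_bcq I q"
    by (auto simp: sat_bcq_def)
qed

end


section \<open>Completeness of the simulation\<close>

locale simulation_model = simulation \<D> \<Q> \<Sigma> f
  for \<D> \<Q> :: "'s relsym set" and \<Sigma> :: "('s, 'c) dtgd set" and f :: "('s, 'c) aux \<Rightarrow> 's relsym" +
  fixes J :: "('s, 'c) instance"
  assumes instance_J: "is_instance J"
    and sat_J: "\<rho> \<in> rules \<Longrightarrow> sat_dtgd J \<rho>"
begin

abbreviation elem :: "'c val \<Rightarrow> bool" where
  "elem x \<equiv> Atom (f Elem) [x] \<in> J"

abbreviation split :: "'c val \<Rightarrow> 'c val \<Rightarrow> 'c val \<Rightarrow> bool" where
  "split u v v' \<equiv> Atom (f Or) [u, v, v'] \<in> J"

abbreviation pair :: "'c val \<Rightarrow> 'c val \<Rightarrow> 'c val \<Rightarrow> 'c val \<Rightarrow> bool" where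
  "pair v x x' y \<equiv> Atom (f Pair) [v, x, x', y] \<in> J"

section \<open>Closure properties of the worlds in a model of the TGDs\<close>

lemma length_world: "R \<in> S \<Longrightarrow> Atom (f (Star R)) (u # xs) \<in> J \<Longrightarrow> length xs = arity R"
  using instance_J by (force simp: is_instance_def wf_atom_def arity_f)

lemma world_atom: "Atom R xs \<in> world J u \<longleftrightarrow> R \<in> S \<and> Atom (f (Star R)) (u # xs) \<in> J"
  by (simp add: world_def)

lemma ex_root: "\<exists>r. Atom (f Root) [r] \<in> J \<and> elem r"
proof -
  have "sat_dtgd J root_rule"
    by (rule sat_J) (simp add: rules_def)
  then show ?thesis
    by (auto simp: root_rule_def sat_tgd_iff)
qed

lemma load:
  assumes "R \<in> S \<inter> \<D>" "Atom (f Root) [r] \<in> J" "Atom R xs \<in> J"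
  shows "Atom R xs \<in> world J r"
proof -
  have "sat_dtgd J (load_rule R)"
    by (rule sat_J) (use assms in \<open>simp add: rules_def\<close>)
  moreover have "length xs = arity R"
    using instance_J assms(3) by (force simp: is_instance_def wf_atom_def)
  ultimately show ?thesis
    using full_tgdD[of J _ _ "asg r r r xs [] []"] assms
    by (fastforce simp: load_rule_def world_atom conj_vars_def)
qed

lemma answer:
  assumes "R \<in> S \<inter> \<Q>" "Atom (f Root) [r] \<in> J" "Atom R xs \<in> world J r"
  shows "Atom R xs \<in> J"
proof -
  have "sat_dtgd J (answer_rule R)"
    by (rule sat_J) (use assms in \<open>simp add: rules_def\<close>)
  moreover have "length xs = arity R"
    using assms length_world by (auto simp: world_atom)
  ultimately show ?thesis
    using full_tgdD[of J _ _ "asg r r r xs [] []"] assms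
    by (fastforce simp: answer_rule_def world_atom conj_vars_def)
qed

lemma world_elem:
  assumes "Atom R xs \<in> world J u" "x \<in> set xs"
  shows "elem x"
proof -
  have R: "R \<in> S" "length xs = arity R"
    using assms length_world by (auto simp: world_atom)
  let ?\<mu> = "asg u u u xs [] []"
  have "sat_dtgd J (elem_rule R)"
    by (rule sat_J) (use R in \<open>simp add: rules_def\<close>)
  then have "conj_holds J ?\<mu> (map (\<lambda>t. Atom (f Elem) [t]) (tup 3 (arity R)))"
    unfolding elem_rule_def
    by (rule full_tgdD) (use R assms(1) in \<open>auto simp: conj_vars_def world_atom\<close>)
  moreover have "x \<in> eval_trm ?\<mu> ` set (tup 3 (arity R))"
    using assms(2) R eval_tup_asg(1)[of xs "arity R"] by (metis set_map)
  ultimately show ?thesis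
    by auto
qed

lemma split_elem: "split u v v' \<Longrightarrow> elem v \<and> elem v'"
proof -
  have "sat_dtgd J world_rule"
    by (rule sat_J) (simp add: rules_def)
  moreover assume "split u v v'"
  ultimately show ?thesis
    using full_tgdD[of J _ _ "asg u v v' [] [] []"]
    by (fastforce simp: world_rule_def conj_vars_def)
qed

lemma split_mono:
  assumes "split u v v'"
  shows "world J u \<subseteq> world J v \<inter> world J v'"
proof
  fix a assume a: "a \<in> world J u"
  obtain R xs where [simp]: "a = Atom R xs"
    by (cases a)
  have R: "R \<in> S" "length xs = arity R"
    using a length_world by (auto simp: world_atom)
  let ?\<mu> = "asg u v v' xs [] []"
  have "sat_dtgd J (inherit_rule R)"
    by (rule sat_J) (use R in \<open>simp add: rules_def\<close>)
  then have "conj_holds J ?\<mu> [Atom (f (Star R)) (Var 1 # tup 3 (arity R)),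
      Atom (f (Star R)) (Var 2 # tup 3 (arity R))]"
    unfolding inherit_rule_def
    by (rule full_tgdD) (use R a assms in \<open>auto simp: conj_vars_def world_atom\<close>)
  then show "a \<in> world J v \<inter> world J v'"
    using R by (simp add: world_atom)
qed

lemma ex_pair:
  assumes "elem v" "elem x" "elem x'"
  shows "\<exists>y. pair v x x' y"
proof -
  let ?b = "[Atom (f Elem) [Var 0], Atom (f Elem) [Var 1], Atom (f Elem) [Var 2]] :: ('s, 'c) conj"
  let ?\<mu> = "asg v x x' [] [] []"
  have "sat_dtgd J (DTGD ?b [[Atom (f Pair) [Var 0, Var 1, Var 2, Var 3]]])"
    unfolding pair_rule_def[symmetric] by (rule sat_J) (simp add: rules_def)
  moreover have "conj_holds J ?\<mu> ?b"
    using assms by simp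
  ultimately obtain \<nu> where \<nu>: "\<forall>i\<in>conj_vars ?b. \<nu> i = ?\<mu> i"
    "conj_holds J \<nu> [Atom (f Pair) [Var 0, Var 1, Var 2, Var 3]]"
    unfolding sat_tgd_iff by blast
  from \<nu>(1) have "\<nu> 0 = v" "\<nu> 1 = x" "\<nu> 2 = x'"
    by (simp_all add: conj_vars_def)
  then have "pair v x x' (\<nu> 3)"
    using \<nu>(2) by simp
  then show ?thesis ..
qed

lemma pair_diag:
  assumes "elem v" "elem x"
  shows "pair v x x x"
proof -
  have "sat_dtgd J diag_rule"
    by (rule sat_J) (simp add: rules_def)
  then show ?thesis
    using full_tgdD[of J _ _ "asg v x x [] [] []"] assms
    by (fastforce simp: diag_rule_def conj_vars_def)
qed

lemma split_product:
  assumes "split u v v'" "Atom R xs \<in> world J v" "Atom R ys \<in> world J v'" "length zs = arity R"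
    and "\<And>j. j < arity R \<Longrightarrow> pair v (xs ! j) (ys ! j) (zs ! j)"
  shows "Atom R zs \<in> world J u"
proof -
  have R: "R \<in> S" "length xs = arity R" "length ys = arity R"
    using assms length_world by (auto simp: world_atom)
  let ?\<mu> = "asg u v v' xs ys zs"
  have "sat_dtgd J (product_rule R)"
    by (rule sat_J) (use R in \<open>simp add: rules_def\<close>)
  then have "conj_holds J ?\<mu> [Atom (f (Star R)) (Var 0 # tup 5 (arity R))]"
    unfolding product_rule_def
  proof (rule full_tgdD, goal_cases)
    case 1
    then show ?case
      by (auto simp: conj_vars_def tup_def)
  next
    case 2
    then show ?case
      using R assms by (simp add: world_atom)
  qed
  then show ?thesis
    using R assms(4) by (simp add: world_atom)
qed

text \<open>Two matches of \<open>q\<close> combine coordinatewise into a match in the product,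
  whose facts have been written into \<open>u\<close>.\<close>

lemma split_bcq:
  assumes split: "split u v v'" and q: "sat_bcq (world J v) q" "sat_bcq (world J v') q"
  shows "sat_bcq (world J u) q"
proof -
  obtain h h' where h: "conj_holds (world J v) h q" and h': "conj_holds (world J v') h' q"
    using q by (auto simp: sat_bcq_def)
  \<comment> \<open>One choice per variable, independent of the atom, keeps shared variables
    consistent. A pair is known to exist only for variables of \<open>q\<close>, whose values occur
    in facts and hence satisfy \<open>elem\<close>.\<close>
  define g where "g x = (SOME y. pair v (h x) (h' x) y)" for x
  have "map_atom (eval_trm g) a \<in> world J u" if a: "a \<in> set q" for a
  proof -
    have v: "Atom (rel a) (map (eval_trm h) (args a)) \<in> world J v"
      and v': "Atom (rel a) (map (eval_trm h') (args a)) \<in> world J v'"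
      using h h' a by (auto simp: conj_holds_def map_atom_eq)
    then have len: "length (args a) = arity (rel a)"
      using length_world by (force simp: world_atom)
    have pair: "pair v (eval_trm h t) (eval_trm h' t) (eval_trm g t)" if "t \<in> set (args a)" for t
    proof -
      have el: "elem v" "elem (eval_trm h t)" "elem (eval_trm h' t)"
        using split_elem[OF split] world_elem[OF v] world_elem[OF v'] that by auto
      show ?thesis
      proof (cases t)
        case (Cst c)
        then show ?thesis using el pair_diag by simp
      next
        case (Var x)
        then have "\<exists>y. pair v (h x) (h' x) y"
          using el ex_pair by simp
        then have "pair v (h x) (h' x) (g x)"
          unfolding g_def by (rule someI_ex)
        then show ?thesis using Var by simp
      qed
    qed
    show ?thesis
      unfolding map_atom_eq
      by (rule split_product[OF split v v']) (use pair len in auto)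
  qed
  then show ?thesis
    by (auto simp: sat_bcq_def conj_holds_def)
qed

text \<open>By \<open>split_bcq\<close>, at least one side of each split still refutes
  \<open>q\<close>. If it is the first side, its disjunct holds there; otherwise the descent
  continues on the second side. Worlds only grow along the way.\<close>

lemma chain_split:
  assumes "conj_holds J \<mu> (chain i \<psi>s)" "\<psi>s \<noteq> []" "elem (\<mu> i)" "\<not> sat_bcq (world J (\<mu> i)) q"
    and "\<forall>\<psi>\<in>set \<psi>s. rel ` set \<psi> \<subseteq> S"
  shows "\<exists>u. elem u \<and> world J (\<mu> i) \<subseteq> world J u \<and> \<not> sat_bcq (world J u) q \<and>
    (\<exists>\<psi>\<in>set \<psi>s. conj_holds (world J u) (\<lambda>x. \<mu> (2 * x)) \<psi>)"
  using assms
proof (induction i \<psi>s rule: chain.induct)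
  case (2 i \<psi>)
  then show ?case
    by (intro exI[of _ "\<mu> i"]) (simp add: conj_holds_star)
next
  case (3 i \<psi> \<psi>' \<psi>s)
  have split: "split (\<mu> i) (\<mu> (i + 2)) (\<mu> (i + 4))"
    and \<psi>: "conj_holds (world J (\<mu> (i + 2))) (\<lambda>x. \<mu> (2 * x)) \<psi>"
    and rest: "conj_holds J \<mu> (chain (i + 4) (\<psi>' # \<psi>s))"
    using "3.prems" conj_holds_star[of \<psi> J \<mu> "i + 2"] by auto
  consider "\<not> sat_bcq (world J (\<mu> (i + 2))) q" | "\<not> sat_bcq (world J (\<mu> (i + 4))) q"
    using split_bcq[OF split] "3.prems"(4) by blast
  then show ?case
  proof cases
    case 1
    then show ?thesis
      using \<psi> split_elem[OF split] split_mono[OF split]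
      by (intro exI[of _ "\<mu> (i + 2)"]) auto
  next
    case 2
    have "\<exists>u. elem u \<and> world J (\<mu> (i + 4)) \<subseteq> world J u \<and> \<not> sat_bcq (world J u) q \<and>
        (\<exists>\<psi>\<in>set (\<psi>' # \<psi>s). conj_holds (world J u) (\<lambda>x. \<mu> (2 * x)) \<psi>)"
      using rest 2 split_elem[OF split] "3.prems"(5) by (intro "3.IH") auto
    then show ?thesis
      using split_mono[OF split] by (meson Int_subset_iff list.set_intros(2) subset_trans)
  qed
qed simp

text \<open>The resulting fact does not mention \<open>u\<close>: witnesses found in one world can
  be used in every world that contains the same match.\<close>

lemma ex_witness:
  assumes "\<sigma> \<in> \<Sigma>" "conj_holds (world J u) \<mu> (body \<sigma>)"
  shows "\<exists>\<nu>. (\<forall>x\<in>conj_vars (body \<sigma>). \<nu> x = \<mu> x) \<and>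
    Atom (f (Ev \<sigma>)) (map \<nu> (dtgd_vars \<sigma>)) \<in> J"
proof -
  define \<mu>' where "\<mu>' x = (if even x then \<mu> (x div 2) else u)" for x
  have "conj_holds J \<mu>' (star 1 (body \<sigma>))"
    using assms by (subst conj_holds_star) (auto simp: \<mu>'_def syms_conjs[OF assms(1) body_conj])
  moreover have "sat_dtgd J (witness_rule \<sigma>)"
    by (rule sat_J) (use assms in \<open>simp add: rules_def\<close>)
  ultimately obtain \<nu> where \<nu>: "\<forall>x\<in>conj_vars (star 1 (body \<sigma>)). \<nu> x = \<mu>' x"
    "conj_holds J \<nu> [Ev_atom \<sigma>]"
    unfolding witness_rule_def sat_tgd_iff by blast
  have "\<nu> (2 * x) = \<mu> x" if "x \<in> conj_vars (body \<sigma>)" for x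
    using \<nu>(1) conj_vars_star_ge[OF that, of 1] by (auto simp: \<mu>'_def)
  then show ?thesis
    using \<nu>(2) by (intro exI[of _ "\<lambda>x. \<nu> (2 * x)"]) (auto simp: Ev_atom_def comp_def)
qed

lemma ex_split:
  assumes "\<sigma> \<in> \<Sigma>" "elem u" "\<not> sat_bcq (world J u) q"
    and "conj_holds (world J u) \<nu> (body \<sigma>)" "Atom (f (Ev \<sigma>)) (map \<nu> (dtgd_vars \<sigma>)) \<in> J"
  shows "\<exists>u'. elem u' \<and> world J u \<subseteq> world J u' \<and> \<not> sat_bcq (world J u') q \<and>
    (\<exists>\<psi>\<in>set (heads \<sigma>). conj_holds (world J u') \<nu> \<psi>)"
proof -
  let ?b = "Atom (f Elem) [Var 1] # Ev_atom \<sigma> # star 1 (body \<sigma>)"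
  define \<mu> where "\<mu> x = (if even x then \<nu> (x div 2) else u)" for x
  have "conj_holds J \<mu> (star 1 (body \<sigma>))"
    using assms by (subst conj_holds_star) (auto simp: \<mu>_def syms_conjs[OF assms(1) body_conj])
  then have "conj_holds J \<mu> ?b"
    using assms by (auto simp: Ev_atom_def \<mu>_def comp_def)
  moreover have "sat_dtgd J (split_rule \<sigma>)"
    by (rule sat_J) (use assms in \<open>simp add: rules_def\<close>)
  ultimately obtain \<nu>' where \<nu>': "\<forall>x\<in>conj_vars ?b. \<nu>' x = \<mu> x" "conj_holds J \<nu>' (chain 1 (heads \<sigma>))"
    unfolding split_rule_def sat_tgd_iff by blast
  have "\<nu>' x = \<mu> x" if "x = 1 \<or> x \<in> (*) 2 ` set (dtgd_vars \<sigma>)" for x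
    using \<nu>'(1) that by (auto simp: conj_vars_def Ev_atom_def)
  then have u: "\<nu>' 1 = u" and \<nu>: "\<And>x. x \<in> set (dtgd_vars \<sigma>) \<Longrightarrow> \<nu>' (2 * x) = \<nu> x"
    by (auto simp: \<mu>_def)
  have "\<exists>u'. elem u' \<and> world J (\<nu>' 1) \<subseteq> world J u' \<and> \<not> sat_bcq (world J u') q \<and>
      (\<exists>\<psi>\<in>set (heads \<sigma>). conj_holds (world J u') (\<lambda>x. \<nu>' (2 * x)) \<psi>)"
  proof (rule chain_split)
    show "heads \<sigma> \<noteq> []"
      using dtgds[OF assms(1)] by (simp add: is_dtgd_def)
    show "\<forall>\<psi>\<in>set (heads \<sigma>). rel ` set \<psi> \<subseteq> S"
      using syms_conjs[OF assms(1)] head_conj by blast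
    show "conj_holds J \<nu>' (chain 1 (heads \<sigma>))"
      by (rule \<nu>'(2))
    show "elem (\<nu>' 1)" "\<not> sat_bcq (world J (\<nu>' 1)) q"
      unfolding u by (rule assms)+
  qed
  \<comment> \<open>The rule leaves only worlds to choose: \<open>Ev_atom\<close> puts all variables
    of the disjuncts, existential ones included, into its body.\<close>
  moreover have "conj_holds I (\<lambda>x. \<nu>' (2 * x)) \<psi> \<longleftrightarrow> conj_holds I \<nu> \<psi>" if "\<psi> \<in> set (heads \<sigma>)" for I \<psi>
    using that head_conj by (intro conj_holds_cong \<nu>) (auto simp: set_dtgd_vars)
  ultimately show ?thesis
    unfolding u by blast
qed

text \<open>The model is a limit of the worlds that refute \<open>q\<close>. A match of
  \<open>q\<close> or of a body is finite and thus visible in one such world, so the limit refutes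
  \<open>q\<close>; \<open>ex_split\<close> supplies the enlargements that force a disjunct into
  it.\<close>

lemma ex_countermodel:
  assumes D: "is_database \<D> D" "database_instance D \<subseteq> J" and q: "is_bcq \<Q> q" "\<not> sat_bcq J q"
  shows "\<exists>I. is_instance I \<and> database_instance D \<subseteq> I \<and> (\<forall>\<sigma>\<in>\<Sigma>. sat_dtgd I \<sigma>) \<and> \<not> sat_bcq I q"
proof -
  define D0 where "D0 = {a \<in> database_instance D. rel a \<in> S}"
  define \<W> where "\<W> = {world J u | u. elem u \<and> D0 \<subseteq> world J u \<and> \<not> sat_bcq (world J u) q}"
  have relD: "rel a \<in> \<D>" "wf_atom a" if "a \<in> database_instance D" for a
    using D that by (auto simp: database_instance_def is_database_def wf_atom_def map_atom_eq)
  obtain r where r: "Atom (f Root) [r] \<in> J" "elem r"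
    using ex_root by blast
  have "a \<in> world J r" if "a \<in> D0" for a
    using that D(2) relD load[of "rel a" r "args a"] r by (auto simp: D0_def)
  moreover have "\<not> sat_bcq (world J r) q"
  proof
    assume "sat_bcq (world J r) q"
    then obtain \<mu> where "conj_holds (world J r) \<mu> q"
      by (auto simp: sat_bcq_def)
    then have "conj_holds J \<mu> q"
    proof (rule conj_holds_restrict[rotated])
      fix a assume "rel a \<in> rel ` set q" "a \<in> world J r"
      then show "a \<in> J"
        using q(1) r answer[of "rel a" r "args a"] by (auto simp: is_bcq_def world_def)
    qed
    then show False
      using q(2) by (auto simp: sat_bcq_def)
  qed
  ultimately have "\<W> \<noteq> {}"
    using r by (auto simp: \<W>_def)
  moreover have "D0 \<subseteq> W" if "W \<in> \<W>" for W
    using that by (auto simp: \<W>_def)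
  ultimately have "\<exists>I. D0 \<subseteq> I \<and> (\<forall>F. finite F \<longrightarrow> F \<subseteq> I \<longrightarrow> (\<exists>W\<in>\<W>. F \<subseteq> W)) \<and>
    (\<forall>B \<H>. finite B \<longrightarrow> B \<subseteq> I \<longrightarrow> finite \<H> \<longrightarrow>
       (\<forall>W\<in>\<W>. B \<subseteq> W \<longrightarrow> (\<exists>W'\<in>\<W>. W \<subseteq> W' \<and> (\<exists>H\<in>\<H>. H \<subseteq> W'))) \<longrightarrow>
       (\<exists>H\<in>\<H>. H \<subseteq> I))"
    by (rule ex_saturated_limit)
  then obtain I where I: "D0 \<subseteq> I"
    and cover: "\<forall>F. finite F \<longrightarrow> F \<subseteq> I \<longrightarrow> (\<exists>W\<in>\<W>. F \<subseteq> W)"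
    and step: "\<forall>B \<H>. finite B \<longrightarrow> B \<subseteq> I \<longrightarrow> finite \<H> \<longrightarrow>
       (\<forall>W\<in>\<W>. B \<subseteq> W \<longrightarrow> (\<exists>W'\<in>\<W>. W \<subseteq> W' \<and> (\<exists>H\<in>\<H>. H \<subseteq> W'))) \<longrightarrow>
       (\<exists>H\<in>\<H>. H \<subseteq> I)"
    by (elim exE conjE) (rule that)
  \<comment> \<open>Worlds contain only facts over \<open>S\<close>, so the remaining facts of
    \<open>D\<close> are put back. Rule bodies do not mention their symbols, and neither does
    \<open>q\<close>, the schemas being disjoint.\<close>
  let ?I = "I \<union> database_instance D"
  have "is_instance ?I"
    unfolding is_instance_def
  proof
    fix a assume "a \<in> ?I"
    then show "wf_atom a"
    proof
      assume "a \<in> I"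
      then obtain u where "a \<in> world J u"
        using cover[rule_format, of "{a}"] by (auto simp: \<W>_def)
      then have "length (args a) = arity (rel a)"
        using length_world[of "rel a" u "args a"] by (simp add: world_def)
      then show "wf_atom a"
        by (simp add: wf_atom_def)
    qed (use relD in auto)
  qed
  moreover have "\<not> sat_bcq ?I q"
  proof
    assume "sat_bcq ?I q"
    then obtain \<mu> where "conj_holds ?I \<mu> q"
      by (auto simp: sat_bcq_def)
    then have "conj_holds I \<mu> q"
      by (rule conj_holds_restrict[rotated])
        (use q(1) relD(1) disjoint in \<open>fastforce simp: is_bcq_def\<close>)
    then obtain W where "W \<in> \<W>" "conj_holds W \<mu> q"
      using cover[rule_format, of "map_atom (eval_trm \<mu>) ` set q"] by (auto simp: conj_holds_iff_subset)
    then show False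
      by (auto simp: \<W>_def sat_bcq_def)
  qed
  moreover have "sat_dtgd ?I \<sigma>" if "\<sigma> \<in> \<Sigma>" for \<sigma>
    unfolding sat_dtgd_def
  proof (intro allI impI)
    fix \<mu> assume "conj_holds ?I \<mu> (body \<sigma>)"
    then have body: "conj_holds I \<mu> (body \<sigma>)"
      by (rule conj_holds_restrict[rotated])
        (use I syms_conjs[OF that body_conj] in \<open>auto simp: D0_def\<close>)
    \<comment> \<open>This world serves only to obtain the witnesses \<open>\<nu>\<close>.\<close>
    obtain W where "W \<in> \<W>" "map_atom (eval_trm \<mu>) ` set (body \<sigma>) \<subseteq> W"
      using cover[rule_format, of "map_atom (eval_trm \<mu>) ` set (body \<sigma>)"] body
      by (auto simp: conj_holds_iff_subset)
    then obtain u where "conj_holds (world J u) \<mu> (body \<sigma>)"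
      by (auto simp: \<W>_def conj_holds_iff_subset)
    from ex_witness[OF that this] obtain \<nu>
      where \<nu>: "\<forall>x\<in>conj_vars (body \<sigma>). \<nu> x = \<mu> x" "Atom (f (Ev \<sigma>)) (map \<nu> (dtgd_vars \<sigma>)) \<in> J"
      by blast
    have body': "conj_holds I \<nu> (body \<sigma>)"
      using body \<nu>(1) conj_holds_cong[of "body \<sigma>" \<nu> \<mu>] by simp
    \<comment> \<open>The head instances under this single \<open>\<nu>\<close> form one finite
      family for all worlds; only which of them is met depends on the world.\<close>
    have "\<exists>H\<in>(\<lambda>\<psi>. map_atom (eval_trm \<nu>) ` set \<psi>) ` set (heads \<sigma>). H \<subseteq> I"
    proof (rule step[rule_format, of "map_atom (eval_trm \<nu>) ` set (body \<sigma>)"])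
      fix W assume W: "W \<in> \<W>" "map_atom (eval_trm \<nu>) ` set (body \<sigma>) \<subseteq> W"
      then obtain u where u: "W = world J u" "elem u" "D0 \<subseteq> W" "\<not> sat_bcq (world J u) q"
        by (auto simp: \<W>_def)
      have "conj_holds (world J u) \<nu> (body \<sigma>)"
        using W u by (simp add: conj_holds_iff_subset)
      from ex_split[OF that u(2,4) this \<nu>(2)] obtain u' \<psi>
        where u': "elem u'" "W \<subseteq> world J u'" "\<not> sat_bcq (world J u') q"
          and \<psi>: "\<psi> \<in> set (heads \<sigma>)" "conj_holds (world J u') \<nu> \<psi>"
        unfolding u(1) by blast
      have "world J u' \<in> \<W>"
        using u(3) u' by (auto simp: \<W>_def)
      then show "\<exists>W'\<in>\<W>. W \<subseteq> W' \<and>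
          (\<exists>H\<in>(\<lambda>\<psi>. map_atom (eval_trm \<nu>) ` set \<psi>) ` set (heads \<sigma>). H \<subseteq> W')"
        using u'(2) \<psi> by (auto simp: conj_holds_iff_subset)
    qed (use body' in \<open>simp_all add: conj_holds_iff_subset\<close>)
    then obtain \<psi> where "\<psi> \<in> set (heads \<sigma>)" "conj_holds I \<nu> \<psi>"
      by (auto simp: conj_holds_iff_subset)
    then show "\<exists>\<nu>. (\<forall>x\<in>conj_vars (body \<sigma>). \<nu> x = \<mu> x) \<and> (\<exists>\<psi>\<in>set (heads \<sigma>). conj_holds ?I \<nu> \<psi>)"
      using \<nu>(1) conj_holds_mono[of I \<nu> _ ?I] by blast
  qed
  ultimately show ?thesis
    by blast
qed

end

section \<open>Equivalence of the two sets of rules\<close>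

lemma (in simulation) simulated_if_entails:
  assumes D: "is_database \<D> D" and q: "is_bcq \<Q> q" and ent: "entails D \<Sigma> q"
  shows "entails D rules q"
  unfolding entails_def
proof (intro allI impI, elim conjE)
  fix J :: "('s, 'c) instance"
  assume J: "is_instance J" "database_instance D \<subseteq> J" "\<forall>\<rho>\<in>rules. sat_dtgd J \<rho>"
  interpret simulation_model \<D> \<Q> \<Sigma> f J
    using J by unfold_locales auto
  show "sat_bcq J q"
    using ex_countermodel[OF D J(2) q] ent unfolding entails_def by blast
qed

theorem theorem4:
  fixes \<D> \<Q> :: "'s relsym set"
    and \<Sigma> :: "('s, 'c :: infinite) dtgd set"
  assumes disjoint: "\<D> \<inter> \<Q> = {}"
    and spare_symbols: "\<And>n. infinite {R. arity R = n \<and> R \<notin> \<D> \<union> \<Q>}"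
    and finite: "finite \<Sigma>"
    and dtgds: "\<forall>\<sigma>\<in>\<Sigma>. is_dtgd \<sigma>"
    and ontology: "omqa_ontology \<D> \<Q> (defined_ontology \<D> \<Q> \<Sigma>)"
  shows "\<exists>\<Sigma>' :: ('s, 'c) dtgd set. finite \<Sigma>' \<and> (\<forall>\<sigma>\<in>\<Sigma>'. is_tgd \<sigma>) \<and>
           defined_ontology \<D> \<Q> \<Sigma>' = defined_ontology \<D> \<Q> \<Sigma>"
proof -
  obtain f :: "('s, 'c) aux \<Rightarrow> 's relsym" where "inj_on f (aux_names \<Sigma>)"
    "\<forall>n\<in>aux_names \<Sigma>. arity (f n) = aux_arity n \<and> f n \<notin> \<D> \<union> \<Q>"
    using ex_fresh_symbols[OF finite_aux_names[OF finite] spare_symbols] by blast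
  then interpret simulation \<D> \<Q> \<Sigma> f
    using disjoint finite dtgds by unfold_locales auto
  have "defined_ontology \<D> \<Q> rules = defined_ontology \<D> \<Q> \<Sigma>"
    using entails_if_simulated simulated_if_entails by (auto simp: defined_ontology_def)
  then show ?thesis
    using finite_simulation tgds_simulation by blast
qed

end
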